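(* Given arbitrary nonnegative integers $k$ and $d$ with $0 \leq 2k \leq d$, there exists a Gorenstein Fano polytope $\mathcal{P} \subset \mathbb{R}^d$ of dimension $d$ such that its Ehrhart polynomial $i(\mathcal{P}, n)$ satisfies all of the following: (i) $i(\mathcal{P}, n)$ possesses $d$ distinct roots (in $\mathbb{C}$); (ii) $i(\mathcal{P}, n)$ possesses exactly $2k$ imaginary roots; (iii) $i(\mathcal{P}, n)$ possesses exactly $d - 2k$ real roots; (iv) the real part of each of the imaginary roots is equal to $-1/2$; (v) all of the real roots belong to the open interval $(-1, 0)$.
   Context: An integral convex polytope is a convex polytope all of whose vertices have integer coordinates. For an integral convex polytope $\mathcal{P} \subset \mathbb{R}^N$ of dimension $d$ and $n = 1, 2, \ldots$, put $i(\mathcal{P}, n) = |n\mathcal{P} \cap \mathbb{Z}^N|$, where $n\mathcal{P} = \{ n\alpha : \alpha \in \mathcal{P} \}$. By Ehrhart's theorem, $i(\mathcal{P}, n)$ is a polynomial in $n$ of degree $d$ with $i(\mathcal{P}, 0) = 1$; it is called the Ehrhart polynomial of $\mathcal{P}$. A complex number $a$ is called a root of $i(\mathcal{P}, n)$ if $i(\mathcal{P}, a) = 0$. An imaginary root means a root in $\mathbb{C} \setminus \mathbb{R}$ (a non-real root). A Fano polytope is an integral convex polytope $\mathcal{P} \subset \mathbb{R}^d$ of dimension $d$ such that the origin of $\mathbb{R}^d$ is the unique integer point belonging to the interior $\mathcal{P} \setminus \partial\mathcal{P}$ of $\mathcal{P}$. The dual polytope of a Fano polytope $\mathcal{P}$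 is the convex polytope $\mathcal{P}^\vee = \{ x \in \mathbb{R}^d : \langle x, y \rangle \leq 1 \text{ for all } y \in \mathcal{P} \}$, where $\langle x, y \rangle$ is the usual inner product of $\mathbb{R}^d$. A Fano polytope is called Gorenstein if its dual polytope is integral. *)

theory Defs
  imports
    "HOL-Analysis.Analysis"
    "HOL-Library.Function_Algebras"
    "HOL-Computational_Algebra.Polynomial"
begin

text \<open>
  The space \<open>\<real>\<^sup>d\<close>, with \<open>d\<close> a variable natural number (\<open>d = 0\<close> included), is the library's
  \<^const>\<open>Euclidean_space\<close>: the sequences \<open>nat \<Rightarrow> real\<close> vanishing from index \<open>d\<close> on, with the
  topology induced by the product topology.  The pointwise vector space structure below makes the
  library notions of convex hull, polytope, extreme point and dimension available for such sequences.
\<close>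

instantiation "fun" :: (type, real_vector) real_vector
begin

definition "scaleR r f = (\<lambda>x. r *\<^sub>R f x)"

instance
  by standard (simp_all add: scaleR_fun_def fun_eq_iff scaleR_add_right scaleR_add_left)

end

lemma scaleR_fun_apply [simp]: "(r *\<^sub>R f) x = r *\<^sub>R f x"
  by (simp add: scaleR_fun_def)

definition integer_point :: "(nat \<Rightarrow> real) \<Rightarrow> bool" where
  "integer_point x \<longleftrightarrow> (\<forall>i. x i \<in> \<int>)"

definition integral_polytope :: "(nat \<Rightarrow> real) set \<Rightarrow> bool" where
  "integral_polytope P \<longleftrightarrow> polytope P \<and> (\<forall>v. v extreme_point_of P \<longrightarrow> integer_point v)"

text \<open>
  The library's \<open>aff_dim\<close> is confined to the class \<open>euclidean_space\<close>; the dimension of the affine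
  hull is therefore taken as the dimension of its direction space, spanned by the differences of
  points.  (The empty set, of no concern here, gets dimension 0 rather than -1.)
\<close>

definition polytope_dim :: "(nat \<Rightarrow> real) set \<Rightarrow> nat" where
  "polytope_dim P = dim {x - y | x y. x \<in> P \<and> y \<in> P}"

definition fano_polytope :: "nat \<Rightarrow> (nat \<Rightarrow> real) set \<Rightarrow> bool" where
  "fano_polytope d P \<longleftrightarrow>
     P \<subseteq> topspace (Euclidean_space d) \<and> integral_polytope P \<and> polytope_dim P = d \<and>
     {x \<in> Euclidean_space d interior_of P. integer_point x} = {0}"

definition dual_polytope :: "nat \<Rightarrow> (nat \<Rightarrow> real) set \<Rightarrow> (nat \<Rightarrow> real) set" where
  "dual_polytope d P =
     {x \<in> topspace (Euclidean_space d). \<forall>y\<in>P. (\<Sum>i<d. x i * y i) \<le> 1}"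

definition gorenstein_fano_polytope :: "nat \<Rightarrow> (nat \<Rightarrow> real) set \<Rightarrow> bool" where
  "gorenstein_fano_polytope d P \<longleftrightarrow>
     fano_polytope d P \<and> integral_polytope (dual_polytope d P)"

definition ehrhart_count :: "(nat \<Rightarrow> real) set \<Rightarrow> nat \<Rightarrow> nat" where
  "ehrhart_count P n = card {x \<in> (\<lambda>\<alpha>. real n *\<^sub>R \<alpha>) ` P. integer_point x}"

text \<open>
  The counting function is prescribed at positive integers only; this determines the polynomial
  (lemma \<open>ehrhart_polynomial_unique\<close>).  Complex coefficients allow evaluation at complex numbers.
\<close>

definition ehrhart_polynomial :: "(nat \<Rightarrow> real) set \<Rightarrow> complex poly \<Rightarrow> bool" where
  "ehrhart_polynomial P p \<longleftrightarrow> (\<forall>n\<ge>1. poly p (of_nat n) = of_nat (ehrhart_count P n))"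

lemma ehrhart_polynomial_unique:
  assumes "ehrhart_polynomial P p" "ehrhart_polynomial P q"
  shows "p = q"
proof (rule ccontr)
  assume "p \<noteq> q"
  then have "finite {z. poly (p - q) z = 0}"
    by (intro poly_roots_finite) simp
  moreover have "of_nat ` {1..} \<subseteq> {z. poly (p - q) z = 0}"
    using assms by (auto simp: ehrhart_polynomial_def)
  ultimately have "finite (of_nat ` {1..} :: complex set)"
    by (rule rev_finite_subset)
  then have "finite {1::nat..}"
    by (rule finite_imageD) (simp add: inj_on_def)
  then show False
    by (simp add: infinite_Ici)
qed

end

theory Submission
  imports Defs "HOL-Computational_Algebra.Fundamental_Theorem_Algebra"
begin

text \<open>
  The Ehrhart polynomial of a product of polytopes is the product of the Ehrhart polynomials, and a
  product of Gorenstein Fano polytopes is again Gorenstein Fano.  So it suffices to find, for every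
  \<open>m\<close>, a Gorenstein Fano polytope of dimension \<open>m\<close> whose Ehrhart polynomial has \<open>m\<close> distinct roots,
  all in \<open>(-1, 0)\<close>, and for every even \<open>l\<close> one of dimension \<open>l\<close> whose Ehrhart polynomial has \<open>l\<close>
  distinct non-real roots, all of real part \<open>-1/2\<close>.  The two root sets are disjoint, and the
  polytope sought is the product for \<open>m = d - 2 k\<close> and \<open>l = 2 k\<close>.

  Both factors are simplices, and they are dual to each other.  The first one is the \<open>(m + 1)\<close>-fold
  dilation of the standard simplex, translated so that its interior lattice point becomes the origin:
  all \<open>x\<^sub>j \<ge> -1\<close> and \<open>\<Sum>x\<^sub>j \<le> 1\<close>.  It has \<open>((m + 1) n + m) choose m\<close> lattice points in its
  \<open>n\<close>-th dilation, a polynomial in \<open>n\<close> with roots \<open>- i / (m + 1)\<close> for \<open>1 \<le> i \<le> m\<close>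
  (lemma \<open>ehrhart_count_dilated_simplex\<close>).

  The second one is the convex hull of the \<open>l + 1\<close> vectors \<open>-e\<^sub>j\<close> and \<open>\<Sum>e\<^sub>j\<close>, whose sum is 0.
  A lattice point is a combination of these vectors with natural coefficients, unique if the least
  coefficient is to be 0, and it lies in the \<open>n\<close>-th dilation iff those coefficients sum to at most
  \<open>n\<close>.  Counting all coefficient families of sum at most \<open>n\<close> and discarding the everywhere positive
  ones gives \<open>(n + l + 1) choose (l + 1)\<close> minus \<open>n choose (l + 1)\<close>
  (lemma \<open>ehrhart_count_fano_simplex\<close>).
  A complex root \<open>z\<close> thus satisfies \<open>\<Prod>(z + i + 1) = \<Prod>(z - i)\<close>, the products being over \<open>i \<le> l\<close>.
  To the right of the line \<open>Re z = -1/2\<close> every factor on the left exceeds the corresponding one on the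
  right in modulus, and to the left of it the reverse holds, so all roots lie on that line.  There the
  logarithmic derivatives of the two sides have real parts of opposite signs, so the roots are
  simple, and their number is the degree \<open>l\<close>.  The only real candidate \<open>-1/2\<close> fails for even \<open>l\<close>,
  since there the two sides are negatives of each other and not 0.
\<close>

section \<open>Polytopes that are polar to each other\<close>

text \<open>
  Vectors live on an arbitrary set \<open>B\<close> of coordinates, not only on \<open>{..<d}\<close>, so that a product of
  polytopes can be formed as the Minkowski sum of polytopes on disjoint coordinate sets.
\<close>

definition coord_space :: "nat set \<Rightarrow> (nat \<Rightarrow> real) set" where
  "coord_space B = {x. \<forall>i. i \<notin> B \<longrightarrow> x i = 0}"

definition dot :: "nat set \<Rightarrow> (nat \<Rightarrow> real) \<Rightarrow> (nat \<Rightarrow> real) \<Rightarrow> real" where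
  "dot B x y = (\<Sum>i\<in>B. x i * y i)"

definition polar :: "nat set \<Rightarrow> (nat \<Rightarrow> real) set \<Rightarrow> (nat \<Rightarrow> real) set" where
  "polar B A = {x \<in> coord_space B. \<forall>y\<in>A. dot B y x \<le> 1}"

text \<open>
  Lattice polytopes with 0 in the interior that are polar to each other, each given by a finite set
  of lattice points spanning it; so \<open>V\<close> contains the vertices of one polytope and the facet normals
  of the other, and \<open>W\<close> conversely.  This form is symmetric, closed under products, and yields all of
  Gorenstein Fano, facet description and lattice point count without further convex geometry.
\<close>

definition reflexive_pair :: "nat set \<Rightarrow> (nat \<Rightarrow> real) set \<Rightarrow> (nat \<Rightarrow> real) set \<Rightarrow> bool" where
  "reflexive_pair B V W \<longleftrightarrow>
     finite B \<and> finite V \<and> finite W \<and> (\<forall>v\<in>V \<union> W. integer_point v) \<and>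
     convex hull V = polar B W \<and> convex hull W = polar B V"

lemma reflexive_pair_sym: "reflexive_pair B V W \<Longrightarrow> reflexive_pair B W V"
  unfolding reflexive_pair_def by blast

lemma dot_commute: "dot B x y = dot B y x"
  by (simp add: dot_def mult.commute)

lemma dot_zero_right [simp]: "dot B x 0 = 0"
  by (simp add: dot_def)

lemma dot_add_left: "dot B (x + y) z = dot B x z + dot B y z"
  by (simp add: dot_def sum.distrib distrib_right)

lemma dot_add_right: "dot B z (x + y) = dot B z x + dot B z y"
  by (simp add: dot_def sum.distrib distrib_left)

lemma dot_minus_left: "dot B (- x) y = - dot B x y"
  by (simp add: dot_def sum_negf)

lemma dot_diff_left: "dot B (x - y) z = dot B x z - dot B y z"
  by (simp add: dot_def left_diff_distrib sum_subtractf)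

lemma dot_scaleR_left: "dot B (c *\<^sub>R x) z = c * dot B x z"
  by (simp add: dot_def sum_distrib_left mult.assoc)

lemma dot_scaleR_right: "dot B z (c *\<^sub>R x) = c * dot B z x"
  by (simp add: dot_def sum_distrib_left mult.left_commute)

lemma dot_unit:
  assumes "finite B" "i \<in> B"
  shows "dot B y (\<lambda>j. if j = i then s else 0) = s * y i"
  using assms by (simp add: dot_def sum.delta if_distrib cong: if_cong)

lemma dot_Un_disjoint:
  "finite B \<Longrightarrow> finite C \<Longrightarrow> B \<inter> C = {} \<Longrightarrow> dot (B \<union> C) x y = dot B x y + dot C x y"
  by (simp add: dot_def sum.union_disjoint)

lemma dot_coord_space_disjoint:
  "x \<in> coord_space B \<Longrightarrow> B \<inter> C = {} \<Longrightarrow> dot C x y = 0"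
  unfolding dot_def coord_space_def by (intro sum.neutral) auto

lemma convex_dot_le: "convex {y. dot B y x \<le> c}"
  by (rule convexI) (simp add: dot_add_left dot_scaleR_left convex_bound_le)

lemma dot_le_on_convex_hull:
  assumes "\<And>y. y \<in> A \<Longrightarrow> dot B y x \<le> c" "y \<in> convex hull A"
  shows "dot B y x \<le> c"
proof -
  have "convex hull A \<subseteq> {y. dot B y x \<le> c}"
    using assms by (intro hull_minimal convex_dot_le) auto
  with assms show ?thesis by blast
qed

lemma polar_convex_hull: "polar B (convex hull A) = polar B A"
  unfolding polar_def using dot_le_on_convex_hull hull_inc by (metis (no_types, lifting))

lemma convex_polar: "convex (polar B A)"
proof (rule convexI)
  fix x y and u v :: real
  assume *: "x \<in> polar B A" "y \<in> polar B A" "0 \<le> u" "0 \<le> v" "u + v = 1"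
  then show "u *\<^sub>R x + v *\<^sub>R y \<in> polar B A"
    by (auto simp: polar_def coord_space_def dot_add_right dot_scaleR_right intro!: convex_bound_le)
qed

lemma zero_in_coord_space: "0 \<in> coord_space B"
  by (simp add: coord_space_def)

lemma zero_in_polar: "0 \<in> polar B A"
  by (simp add: polar_def coord_space_def)

text \<open>
  The polar of a finite set is a neighbourhood of the origin; small multiples of the unit vectors and
  of their negatives are all that is needed of this fact.
\<close>

lemma small_unit_in_polar:
  assumes "finite B" "finite A" "i \<in> B"
  obtains e where "e > 0" "(\<lambda>j. if j = i then e else 0) \<in> polar B A"
    "(\<lambda>j. if j = i then - e else 0) \<in> polar B A"
proof -
  define M where "M = 1 + (\<Sum>y\<in>A. \<bar>y i\<bar>)"
  have M: "M > 0"
    unfolding M_def by (simp add: add_pos_nonneg sum_nonneg)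
  have "\<bar>y i\<bar> \<le> M" if "y \<in> A" for y
    using member_le_sum[OF that, of "\<lambda>y. \<bar>y i\<bar>"] assms unfolding M_def by simp
  then have le: "y i \<le> M" "- y i \<le> M" if "y \<in> A" for y
    using that by force+
  show thesis
  proof
    show "1 / M > 0" using M by simp
    show "(\<lambda>j. if j = i then 1 / M else 0) \<in> polar B A"
      using assms M le by (auto simp: polar_def coord_space_def dot_unit)
    show "(\<lambda>j. if j = i then - (1 / M) else 0) \<in> polar B A"
      using assms M le by (auto simp: polar_def coord_space_def dot_unit minus_divide_left simp del: divide_minus_left)
  qed
qed

text \<open>
  This is boundedness of the polytope \<open>convex hull V\<close>, expressed on its facet normals \<open>W\<close>: they are
  not contained in a closed half-space through the origin, because their convex hull contains a small
  multiple of every unit vector and of its negative.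
\<close>

lemma reflexive_pair_cone_trivial:
  assumes "reflexive_pair B V W" "x \<in> coord_space B" "\<And>w. w \<in> W \<Longrightarrow> dot B w x \<le> 0"
  shows "x = 0"
proof
  fix i
  show "x i = 0 i"
  proof (cases "i \<in> B")
    case False
    then show ?thesis using assms(2) by (simp add: coord_space_def)
  next
    case True
    have fin: "finite B" "finite V" and hull: "convex hull W = polar B V"
      using assms(1) by (auto simp: reflexive_pair_def)
    obtain e where e: "e > 0" "(\<lambda>j. if j = i then e else 0) \<in> polar B V"
      "(\<lambda>j. if j = i then - e else 0) \<in> polar B V"
      using small_unit_in_polar[OF fin True] by blast
    have "dot B y x \<le> 0" if "y \<in> polar B V" for y
      using dot_le_on_convex_hull[of W B x 0 y] assms(3) that hull by simp
    from this[OF e(2)] this[OF e(3)] have "e * x i \<le> 0" "- e * x i \<le> 0"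
      using dot_unit[OF fin(1) True] by (simp_all add: dot_commute[of B _ x])
    then show ?thesis using e(1)
      by (simp add: mult_le_0_iff zero_le_mult_iff)
  qed
qed

lemma reflexive_pair_hull_in_coord_space:
  "reflexive_pair B V W \<Longrightarrow> convex hull V \<subseteq> coord_space B"
  unfolding reflexive_pair_def polar_def by blast

text \<open>
  For \<open>t > 0\<close> this is scaling; for \<open>t = 0\<close> it is the boundedness above.  The case \<open>t = 0\<close> matters
  for the polar of a product, where one of the two weights may vanish.
\<close>

lemma dilation_reflexive_pair:
  assumes "reflexive_pair B V W" "0 \<le> t"
  shows "(\<lambda>x. t *\<^sub>R x) ` (convex hull V) = {x \<in> coord_space B. \<forall>w\<in>W. dot B w x \<le> t}"
proof (intro equalityI subsetI)
  have hull: "convex hull V = polar B W"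
    using assms(1) by (simp add: reflexive_pair_def)
  fix x
  {
    assume "x \<in> (\<lambda>x. t *\<^sub>R x) ` (convex hull V)"
    then obtain y where "y \<in> polar B W" "x = t *\<^sub>R y" using hull by auto
    then show "x \<in> {x \<in> coord_space B. \<forall>w\<in>W. dot B w x \<le> t}"
      using assms(2) by (auto simp: polar_def coord_space_def dot_scaleR_right mult_left_le)
  next
    assume x: "x \<in> {x \<in> coord_space B. \<forall>w\<in>W. dot B w x \<le> t}"
    show "x \<in> (\<lambda>x. t *\<^sub>R x) ` (convex hull V)"
    proof (cases "t = 0")
      case True
      then have "x = 0"
        using reflexive_pair_cone_trivial[OF assms(1)] x by auto
      then have "x = t *\<^sub>R 0" by simp
      then show ?thesis using hull zero_in_polar by blast
    next
      case False
      then have "(1 / t) *\<^sub>R x \<in> polar B W"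
        using x assms(2) by (auto simp: polar_def coord_space_def dot_scaleR_right divide_le_eq_1)
      moreover have "x = t *\<^sub>R ((1 / t) *\<^sub>R x)"
        using False by simp
      ultimately show ?thesis using hull by blast
    qed
  }
qed

lemma reflexive_pair_in_coord_space:
  assumes "reflexive_pair B V W"
  shows "V \<subseteq> coord_space B" "W \<subseteq> coord_space B"
  using assms hull_subset[of V convex] hull_subset[of W convex]
  by (auto simp: reflexive_pair_def polar_def)

lemma coord_space_split:
  assumes "x \<in> coord_space (B \<union> C)" "B \<inter> C = {}"
  obtains y z where "y \<in> coord_space B" "z \<in> coord_space C" "x = y + z"
proof
  show "(\<lambda>i. if i \<in> B then x i else 0) \<in> coord_space B"
    "(\<lambda>i. if i \<in> C then x i else 0) \<in> coord_space C"
    by (auto simp: coord_space_def)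
  show "x = (\<lambda>i. if i \<in> B then x i else 0) + (\<lambda>i. if i \<in> C then x i else 0)"
    using assms by (auto simp: coord_space_def fun_eq_iff)
qed

lemma coord_space_add:
  "y \<in> coord_space B \<Longrightarrow> z \<in> coord_space C \<Longrightarrow> y + z \<in> coord_space (B \<union> C)"
  by (simp add: coord_space_def)

text \<open>
  Vectors supported on disjoint coordinate sets are orthogonal.
\<close>

lemma dot_split:
  assumes "finite B" "finite C" "B \<inter> C = {}" "v \<in> coord_space B" "v' \<in> coord_space C"
    "y \<in> coord_space B" "z \<in> coord_space C"
  shows "dot (B \<union> C) (v + v') (y + z) = dot B v y + dot C v' z"
    and "dot (B \<union> C) v (y + z) = dot B v y"
    and "dot (B \<union> C) v' (y + z) = dot C v' z"
    and "dot (B \<union> C) (v + v') y = dot B v y"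
    and "dot (B \<union> C) (v + v') z = dot C v' z"
proof -
  have "C \<inter> B = {}" using assms(3) by blast
  then have "dot C v u = 0" "dot B v' u = 0" "dot C u y = 0" "dot B u z = 0" for u
    using assms dot_coord_space_disjoint dot_commute by metis+
  then show "dot (B \<union> C) (v + v') (y + z) = dot B v y + dot C v' z"
    "dot (B \<union> C) v (y + z) = dot B v y" "dot (B \<union> C) v' (y + z) = dot C v' z"
    "dot (B \<union> C) (v + v') y = dot B v y" "dot (B \<union> C) (v + v') z = dot C v' z"
    using assms(1-3) by (simp_all add: dot_Un_disjoint dot_add_left dot_add_right)
qed

text \<open>
  Facet inequalities on disjoint coordinate sets can be imposed independently: they describe a product.
\<close>

lemma polar_Un_coord_spaces:
  assumes "finite B" "finite C" "B \<inter> C = {}" "W \<subseteq> coord_space B" "W' \<subseteq> coord_space C"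
  shows "polar (B \<union> C) (W \<union> W') = polar B W + polar C W'"
proof (intro equalityI subsetI)
  fix x assume x: "x \<in> polar (B \<union> C) (W \<union> W')"
  then have "x \<in> coord_space (B \<union> C)" by (simp add: polar_def)
  then obtain y z where yz: "y \<in> coord_space B" "z \<in> coord_space C" "x = y + z"
    using coord_space_split assms(3) by metis
  have "dot B w y \<le> 1" if "w \<in> W" for w
  proof -
    have "w \<in> coord_space B" "dot (B \<union> C) w x \<le> 1"
      using that x assms(4) by (auto simp: polar_def)
    then show ?thesis using dot_split(2)[OF assms(1-3) _ zero_in_coord_space yz(1,2), of w] yz(3) by simp
  qed
  moreover have "dot C w z \<le> 1" if "w \<in> W'" for w
  proof -
    have "w \<in> coord_space C" "dot (B \<union> C) w x \<le> 1"
      using that x assms(5) by (auto simp: polar_def)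
    then show ?thesis using dot_split(3)[OF assms(1-3) zero_in_coord_space _ yz(1,2), of w] yz(3) by simp
  qed
  ultimately show "x \<in> polar B W + polar C W'"
    using yz by (auto simp: polar_def intro!: set_plus_intro)
next
  fix x assume "x \<in> polar B W + polar C W'"
  then obtain y z where yz: "y \<in> polar B W" "z \<in> polar C W'" "x = y + z"
    by (auto elim: set_plus_elim)
  then have cs: "y \<in> coord_space B" "z \<in> coord_space C" by (auto simp: polar_def)
  have zero: "0 \<in> coord_space B" "0 \<in> coord_space C" by (simp_all add: coord_space_def)
  have "dot (B \<union> C) w x \<le> 1" if "w \<in> W" for w
    using dot_split(2)[OF assms(1-3) _ zero(2) cs, of w] that yz assms(4) by (auto simp: polar_def)
  moreover have "dot (B \<union> C) w x \<le> 1" if "w \<in> W'" for w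
    using dot_split(3)[OF assms(1-3) zero(1) _ cs, of w] that yz assms(5) by (auto simp: polar_def)
  ultimately show "x \<in> polar (B \<union> C) (W \<union> W')"
    using coord_space_add[OF cs] yz(3) by (auto simp: polar_def)
qed

lemma reflexive_pair_nonempty: "reflexive_pair B V W \<Longrightarrow> V \<noteq> {}"
  using zero_in_polar[of B W] by (auto simp: reflexive_pair_def)

text \<open>
  A product has the pairwise sums of the vertices as vertices, and the facet normals of both factors
  as facet normals.  The substantial part is that the polar of the product is spanned by the latter:
  if \<open>y + z\<close> lies in this polar, the support functions of the two factors at \<open>y\<close> and \<open>z\<close> are
  nonnegative numbers of sum at most 1, so \<open>y\<close> and \<open>z\<close> are points of the two polars scaled by weights
  \<open>1 - t\<close> and \<open>t\<close>, and \<open>y + z\<close> is a convex combination.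
\<close>

lemma reflexive_pair_product:
  assumes p: "reflexive_pair B V W" and q: "reflexive_pair C V' W'" and disj: "B \<inter> C = {}"
  shows "reflexive_pair (B \<union> C) (V + V') (W \<union> W')"
proof -
  have fin: "finite B" "finite C" "finite V" "finite V'" "finite W" "finite W'"
    and hulls: "convex hull V = polar B W" "convex hull W = polar B V"
      "convex hull V' = polar C W'" "convex hull W' = polar C V'"
    using p q by (auto simp: reflexive_pair_def)
  note cs = reflexive_pair_in_coord_space[OF p] reflexive_pair_in_coord_space[OF q]
  have 1: "convex hull (V + V') = polar (B \<union> C) (W \<union> W')"
    using cs fin disj by (simp add: convex_hull_set_plus hulls polar_Un_coord_spaces)
  have "W \<union> W' \<subseteq> polar (B \<union> C) (V + V')"
  proof
    fix w assume w: "w \<in> W \<union> W'"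
    have "dot (B \<union> C) (v + v') w \<le> 1" if v: "v \<in> V" "v' \<in> V'" for v v'
    proof (cases "w \<in> W")
      case True
      then have "w \<in> polar B V" using hulls hull_inc by metis
      moreover have "dot (B \<union> C) (v + v') w = dot B v w"
        using dot_split(4)[OF fin(1,2) disj _ _ _ zero_in_coord_space, of v v' w] v cs True by blast
      ultimately show ?thesis using v by (simp add: polar_def)
    next
      case False
      then have "w \<in> polar C V'" using w hulls hull_inc by (metis UnE)
      moreover have "dot (B \<union> C) (v + v') w = dot C v' w"
        using dot_split(5)[OF fin(1,2) disj _ _ zero_in_coord_space, of v v' w] v cs False w by blast
      ultimately show ?thesis using v by (simp add: polar_def)
    qed
    moreover have "w \<in> coord_space (B \<union> C)"
      using w cs by (auto simp: coord_space_def)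
    ultimately show "w \<in> polar (B \<union> C) (V + V')"
      by (auto simp: polar_def elim: set_plus_elim)
  qed
  then have 2: "convex hull (W \<union> W') \<subseteq> polar (B \<union> C) (V + V')"
    by (simp add: hull_minimal convex_polar)
  have 3: "polar (B \<union> C) (V + V') \<subseteq> convex hull (W \<union> W')"
  proof
    fix x assume x: "x \<in> polar (B \<union> C) (V + V')"
    then have "x \<in> coord_space (B \<union> C)" by (simp add: polar_def)
    then obtain y z where yz: "y \<in> coord_space B" "z \<in> coord_space C" "x = y + z"
      using coord_space_split disj by metis
    \<comment> \<open>the value at z of the support function of the second factor\<close>
    define t where "t = Max ((\<lambda>v. dot C v z) ` V')"
    have ne: "V \<noteq> {}" "V' \<noteq> {}"
      using reflexive_pair_nonempty p q by blast+
    have z_le: "dot C v z \<le> t" if "v \<in> V'" for v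
      using that fin unfolding t_def by auto
    have "t \<in> (\<lambda>v. dot C v z) ` V'"
      unfolding t_def using fin ne by (intro Max_in) auto
    then obtain v0 where v0: "v0 \<in> V'" "dot C v0 z = t" by blast
    have y_le: "dot B v y \<le> 1 - t" if "v \<in> V" for v
    proof -
      have "v + v0 \<in> V + V'" using that v0 by (simp add: set_plus_intro)
      then have "dot (B \<union> C) (v + v0) x \<le> 1"
        using x by (simp add: polar_def)
      moreover have "v \<in> coord_space B" "v0 \<in> coord_space C" using that v0 cs by blast+
      ultimately show ?thesis
        using dot_split(1)[OF fin(1,2) disj _ _ yz(1,2), of v v0] v0(2) yz(3) by simp
    qed
    have "t \<ge> 0"
    proof (rule ccontr)
      assume "\<not> 0 \<le> t"
      then have "z = 0"
        using reflexive_pair_cone_trivial[OF reflexive_pair_sym[OF q] yz(2)] z_le by force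
      with v0 \<open>\<not> 0 \<le> t\<close> show False by simp
    qed
    moreover have "1 - t \<ge> 0"
    proof (rule ccontr)
      assume neg: "\<not> 0 \<le> 1 - t"
      then have "y = 0"
        using reflexive_pair_cone_trivial[OF reflexive_pair_sym[OF p] yz(1)] y_le by force
      with neg y_le ne show False by auto
    qed
    ultimately obtain u u' where "u \<in> convex hull W" "y = (1 - t) *\<^sub>R u"
        "u' \<in> convex hull W'" "z = t *\<^sub>R u'"
      using dilation_reflexive_pair[OF reflexive_pair_sym[OF p], of "1 - t"] y_le yz
        dilation_reflexive_pair[OF reflexive_pair_sym[OF q], of t] z_le by blast
    moreover from this have "u \<in> convex hull (W \<union> W')" "u' \<in> convex hull (W \<union> W')"
      using hull_mono[of W "W \<union> W'"] hull_mono[of W' "W \<union> W'"] by blast+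
    ultimately show "x \<in> convex hull (W \<union> W')"
      using yz(3) \<open>t \<ge> 0\<close> \<open>1 - t \<ge> 0\<close> convexD[OF convex_convex_hull, of u "W \<union> W'" u' "1 - t" t]
      by simp
  qed
  have "integer_point v" if "v \<in> (V + V') \<union> (W \<union> W')" for v
    using that p q by (auto simp: reflexive_pair_def integer_point_def elim!: set_plus_elim)
  then show ?thesis
    using 1 2 3 fin by (auto simp: reflexive_pair_def finite_set_plus)
qed

lemma topspace_Euclidean_space_eq: "topspace (Euclidean_space d) = coord_space {..<d}"
  by (auto simp: topspace_Euclidean_space coord_space_def)

lemma integral_polytope_convex_hull:
  "finite V \<Longrightarrow> (\<And>v. v \<in> V \<Longrightarrow> integer_point v) \<Longrightarrow> integral_polytope (convex hull V)"
  unfolding integral_polytope_def polytope_def using extreme_point_of_convex_hull by blast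

lemma sum_fun_apply: "(\<Sum>i\<in>I. f i) j = (\<Sum>i\<in>I. f i j)"
  for f :: "'b \<Rightarrow> 'a \<Rightarrow> 'c :: comm_monoid_add"
  by (induction I rule: infinite_finite_induct) auto

lemma dim_eq_of_small_units:
  fixes D :: "(nat \<Rightarrow> real) set"
  assumes "D \<subseteq> coord_space {..<d}"
    and "\<And>i. i < d \<Longrightarrow> \<exists>e>0. (\<lambda>j. if j = i then e else 0) \<in> D"
  shows "dim D = d"
proof -
  define u :: "nat \<Rightarrow> nat \<Rightarrow> real" where "u = (\<lambda>i j. if j = i then 1 else 0)"
  have inj: "inj_on u A" for A
    by (rule inj_onI) (metis u_def zero_neq_one)
  have "independent (u ` {..<d})"
    unfolding independent_explicit_finite_subsets
  proof safe
    fix A f v assume A: "A \<subseteq> u ` {..<d}" "finite A" and 0: "(\<Sum>v\<in>A. f v *\<^sub>R v) = 0" "v \<in> A"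
    obtain I where I: "I \<subseteq> {..<d}" "A = u ` I" using A by (meson subset_imageE)
    then obtain i where i: "i \<in> I" "v = u i" using 0 by auto
    have "finite I" using I finite_subset by blast
    have "0 = (\<Sum>j\<in>I. f (u j) *\<^sub>R u j) i"
      using 0 I by (simp add: sum.reindex[OF inj])
    also have "\<dots> = (\<Sum>j\<in>I. if j = i then f (u i) else 0)"
      unfolding sum_fun_apply by (intro sum.cong) (auto simp: u_def)
    also have "\<dots> = f v" using i \<open>finite I\<close> by simp
    finally show "f v = 0" by simp
  qed
  moreover have "span D = span (u ` {..<d})"
    unfolding span_eq
  proof (intro conjI subsetI)
    fix x assume "x \<in> D"
    then have x: "x \<in> coord_space {..<d}" using assms(1) by blast
    have "x j = (\<Sum>i<d. x i *\<^sub>R u i) j" for j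
    proof -
      have "(\<Sum>i<d. x i *\<^sub>R u i) j = (\<Sum>i<d. if j = i then x j else 0)"
        unfolding sum_fun_apply by (intro sum.cong) (auto simp: u_def)
      then show ?thesis using x by (simp add: coord_space_def)
    qed
    then have "x = (\<Sum>i<d. x i *\<^sub>R u i)" by blast
    also have "\<dots> \<in> span (u ` {..<d})"
      by (intro span_sum span_scale span_base imageI)
    finally show "x \<in> span (u ` {..<d})" .
  next
    fix v assume "v \<in> u ` {..<d}"
    then obtain i where i: "i < d" "v = u i" by blast
    then obtain e where e: "e > 0" "(\<lambda>j. if j = i then e else 0) \<in> D" using assms(2) by blast
    have "v = (1 / e) *\<^sub>R (\<lambda>j. if j = i then e else 0)"
      using e i by (auto simp: u_def fun_eq_iff)
    then show "v \<in> span D" using e(2) span_base span_scale by metis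
  qed
  ultimately have "dim D = card (u ` {..<d})"
    by (intro real_vector.dim_eq_card) simp_all
  then show ?thesis by (simp add: card_image[OF inj])
qed

lemma polytope_dim_reflexive_pair:
  assumes "reflexive_pair {..<d} V W"
  shows "polytope_dim (convex hull V) = d"
  unfolding polytope_dim_def
proof (rule dim_eq_of_small_units)
  have hull: "convex hull V = polar {..<d} W" and fin: "finite W"
    using assms by (auto simp: reflexive_pair_def)
  show "{x - y |x y. x \<in> convex hull V \<and> y \<in> convex hull V} \<subseteq> coord_space {..<d}"
    by (auto simp: hull polar_def coord_space_def)
  fix i assume "i < d"
  then obtain e where e: "e > 0" "(\<lambda>j. if j = i then e else 0) \<in> polar {..<d} W"
    using small_unit_in_polar[of "{..<d}" W i] fin by auto
  then have "(\<lambda>j. if j = i then e else 0) - 0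
      \<in> {x - y |x y. x \<in> convex hull V \<and> y \<in> convex hull V}"
    unfolding hull using zero_in_polar by blast
  then show "\<exists>e>0. (\<lambda>j. if j = i then e else 0)
      \<in> {x - y |x y. x \<in> convex hull V \<and> y \<in> convex hull V}"
    using e(1) by auto
qed

lemma dot_integer_points:
  "integer_point x \<Longrightarrow> integer_point y \<Longrightarrow> dot B x y \<in> \<int>"
  unfolding dot_def integer_point_def by (intro Ints_sum Ints_mult) auto

text \<open>
  The origin satisfies all facet inequalities \<open>\<langle>w, x\<rangle> \<le> 1\<close> strictly.  Conversely an interior point
  satisfies them strictly, since it may be stretched a little; if it is a lattice point, then
  \<open>\<langle>w, x\<rangle>\<close> is an integer and hence at most 0, and boundedness leaves only the origin.
\<close>

lemma interior_reflexive_pair: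
  assumes "reflexive_pair {..<d} V W"
  shows "{x \<in> Euclidean_space d interior_of (convex hull V). integer_point x} = {0}"
proof (intro equalityI subsetI)
  have hull: "convex hull V = polar {..<d} W" and fin: "finite W"
    using assms by (auto simp: reflexive_pair_def)
  fix x :: "nat \<Rightarrow> real"
  {
    assume "x \<in> {0}"
    define U where "U = {y \<in> topspace (Euclidean_space d). \<forall>w\<in>W. dot {..<d} w y < 1}"
    have "openin (Euclidean_space d) (\<Inter>w\<in>W. {y \<in> topspace (Euclidean_space d). dot {..<d} w y \<in> {..<1}})"
      if "W \<noteq> {}"
    proof (rule openin_Inter)
      show "finite ((\<lambda>w. {y \<in> topspace (Euclidean_space d). dot {..<d} w y \<in> {..<1}}) ` W)"
        using fin by blast
      fix S assume "S \<in> (\<lambda>w. {y \<in> topspace (Euclidean_space d). dot {..<d} w y \<in> {..<1}}) ` W"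
      then obtain w where S: "S = {y \<in> topspace (Euclidean_space d). dot {..<d} w y \<in> {..<1}}"
        by blast
      have "continuous_map (Euclidean_space d) euclideanreal (\<lambda>y. dot {..<d} w y)"
        unfolding continuous_map_Euclidean_space_iff dot_def
        by (intro continuous_intros continuous_on_subset[OF continuous_on_product_coordinates subset_UNIV])
      then show "openin (Euclidean_space d) S"
        unfolding S by (rule openin_continuous_map_preimage) simp
    qed (use that in simp)
    moreover have "W \<noteq> {}"
      using reflexive_pair_nonempty reflexive_pair_sym assms by blast
    moreover from this have "U = (\<Inter>w\<in>W. {y \<in> topspace (Euclidean_space d). dot {..<d} w y \<in> {..<1}})"
      unfolding U_def by auto
    ultimately have "openin (Euclidean_space d) U" by simp
    moreover have "U \<subseteq> convex hull V"
      unfolding U_def hull polar_def topspace_Euclidean_space_eq by force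
    moreover have "0 \<in> U"
      unfolding U_def topspace_Euclidean_space_eq by (simp add: coord_space_def)
    ultimately have "0 \<in> Euclidean_space d interior_of (convex hull V)"
      using interior_of_maximal by blast
    with \<open>x \<in> {0}\<close> show "x \<in> {x \<in> Euclidean_space d interior_of (convex hull V). integer_point x}"
      by (simp add: integer_point_def)
  next
    assume "x \<in> {x \<in> Euclidean_space d interior_of (convex hull V). integer_point x}"
    then obtain U where U: "openin (Euclidean_space d) U" "U \<subseteq> convex hull V" "x \<in> U"
      and int: "integer_point x"
      by (auto simp: interior_of_def)
    have x: "x \<in> coord_space {..<d}"
      using U openin_subset topspace_Euclidean_space_eq by blast
    have "continuous_map euclideanreal (Euclidean_space d) (\<lambda>t i. if i < d then t * x i else 0)"
      unfolding continuous_map_componentwise_Euclidean_space by (auto intro!: continuous_intros)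
    moreover have "(\<lambda>t i. if i < d then t * x i else 0) = (\<lambda>t::real. t *\<^sub>R x)"
      using x by (auto simp: fun_eq_iff coord_space_def)
    ultimately have "continuous_map euclideanreal (Euclidean_space d) (\<lambda>t. t *\<^sub>R x)" by simp
    from openin_continuous_map_preimage[OF this U(1)]
    have "open {t. t *\<^sub>R x \<in> U}" by simp
    moreover have "1 \<in> {t. t *\<^sub>R x \<in> U}" using U by simp
    ultimately obtain e where e: "e > 0" "cball 1 e \<subseteq> {t. t *\<^sub>R x \<in> U}"
      using open_contains_cball by blast
    have "(1 + e) \<in> cball 1 e" using e by (simp add: dist_real_def)
    then have big: "(1 + e) *\<^sub>R x \<in> polar {..<d} W" using e U hull by blast
    have "dot {..<d} w x \<le> 0" if w: "w \<in> W" for w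
    proof -
      have "(1 + e) * dot {..<d} w x \<le> 1"
        using big w by (simp add: polar_def dot_scaleR_right)
      then have "dot {..<d} w x < 1"
        using e(1) by (smt (verit) mult_less_cancel_right1 mult_le_cancel_left1)
      moreover have "dot {..<d} w x \<in> \<int>"
        using assms w int by (auto simp: reflexive_pair_def intro!: dot_integer_points)
      ultimately show ?thesis by (auto elim!: Ints_cases)
    qed
    then show "x \<in> {0}"
      using reflexive_pair_cone_trivial[OF assms x] by simp
  }
qed

lemma gorenstein_fano_reflexive_pair:
  assumes "reflexive_pair {..<d} V W"
  shows "gorenstein_fano_polytope d (convex hull V)"
proof -
  have hull: "convex hull V = polar {..<d} W" "convex hull W = polar {..<d} V"
    and fin: "finite V" "finite W" "\<And>v. v \<in> V \<union> W \<Longrightarrow> integer_point v"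
    using assms by (auto simp: reflexive_pair_def)
  have "dual_polytope d (convex hull V) = polar {..<d} (convex hull V)"
    unfolding dual_polytope_def polar_def topspace_Euclidean_space_eq dot_def
    by (simp add: mult.commute)
  also have "\<dots> = convex hull W"
    by (simp add: polar_convex_hull hull(2))
  finally have "integral_polytope (dual_polytope d (convex hull V))"
    using integral_polytope_convex_hull fin by simp
  moreover have "integral_polytope (convex hull V)"
    using integral_polytope_convex_hull fin by simp
  moreover have "convex hull V \<subseteq> topspace (Euclidean_space d)"
    unfolding hull polar_def topspace_Euclidean_space_eq by blast
  ultimately show ?thesis
    unfolding gorenstein_fano_polytope_def fano_polytope_def
    using polytope_dim_reflexive_pair[OF assms] interior_reflexive_pair[OF assms] by blast
qed

section \<open>Ehrhart counts of polar pairs and of products\<close>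

lemma ehrhart_count_reflexive_pair:
  assumes "reflexive_pair B V W"
  shows "ehrhart_count (convex hull V) n =
    card {x \<in> coord_space B. (\<forall>w\<in>W. dot B w x \<le> real n) \<and> integer_point x}"
  unfolding ehrhart_count_def dilation_reflexive_pair[OF assms of_nat_0_le_iff]
  by (rule arg_cong[where f = card]) blast

text \<open>
  With disjoint coordinate sets the Minkowski sum is a product, and so are the lattice points of its
  dilations.
\<close>

lemma ehrhart_count_set_plus:
  assumes "P \<subseteq> coord_space B" "Q \<subseteq> coord_space C" "B \<inter> C = {}"
  shows "ehrhart_count (P + Q) n = ehrhart_count P n * ehrhart_count Q n"
proof -
  define I where "I = (\<lambda>P. {x \<in> (\<lambda>\<alpha>. real n *\<^sub>R \<alpha>) ` P. integer_point x})"
  have cs: "I P \<subseteq> coord_space B" "I Q \<subseteq> coord_space C"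
    using assms by (auto simp: I_def coord_space_def)
  have off: "x i = 0" if "x \<in> coord_space B" "i \<notin> B" for x i and B
    using that by (simp add: coord_space_def)
  have "inj_on (\<lambda>(x, y). x + y) (I P \<times> I Q)"
  proof (rule inj_onI, clarify, intro conjI ext)
    fix x y x' y' i
    assume *: "x \<in> I P" "y \<in> I Q" "x' \<in> I P" "y' \<in> I Q" and eq: "x + y = x' + y'"
    have "x i + y i = x' i + y' i" using fun_cong[OF eq, of i] by simp
    moreover have "i \<notin> B \<or> i \<notin> C" using assms(3) by blast
    moreover have "x \<in> coord_space B" "x' \<in> coord_space B" "y \<in> coord_space C" "y' \<in> coord_space C"
      using * cs by blast+
    ultimately show "x i = x' i" "y i = y' i"
      using off[of x B i] off[of x' B i] off[of y C i] off[of y' C i] by auto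
  qed
  moreover have "(\<lambda>(x, y). x + y) ` (I P \<times> I Q) = I (P + Q)"
  proof (intro equalityI subsetI)
    fix z assume "z \<in> (\<lambda>(x, y). x + y) ` (I P \<times> I Q)"
    then obtain x y where "x \<in> I P" "y \<in> I Q" "z = x + y" by auto
    then show "z \<in> I (P + Q)"
      unfolding I_def integer_point_def
      by (auto simp: scaleR_add_right[symmetric] intro!: imageI set_plus_intro)
  next
    fix z assume "z \<in> I (P + Q)"
    then obtain x y where xy: "x \<in> P" "y \<in> Q" "z = real n *\<^sub>R x + real n *\<^sub>R y" "integer_point z"
      unfolding I_def by (auto elim!: set_plus_elim simp: scaleR_add_right)
    have "real n * x i \<in> \<int> \<and> real n * y i \<in> \<int>" for i
    proof -
      have "real n * x i + real n * y i \<in> \<int>"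
        using xy(3,4) by (simp add: integer_point_def)
      moreover have "i \<notin> B \<or> i \<notin> C" using assms(3) by blast
      ultimately show ?thesis
        using off[of x B i] off[of y C i] assms(1,2) xy(1,2) by auto
    qed
    then have "real n *\<^sub>R x \<in> I P" "real n *\<^sub>R y \<in> I Q"
      using xy by (auto simp: I_def integer_point_def)
    then show "z \<in> (\<lambda>(x, y). x + y) ` (I P \<times> I Q)" using xy(3) by force
  qed
  ultimately have "card (I (P + Q)) = card (I P \<times> I Q)"
    using card_image by metis
  then show ?thesis
    by (simp add: ehrhart_count_def I_def card_cartesian_product)
qed

section \<open>A simplex and its dual\<close>

definition ones :: "nat set \<Rightarrow> nat \<Rightarrow> real" where
  "ones B = (\<lambda>i. if i \<in> B then 1 else 0)"

definition unit_at :: "nat \<Rightarrow> nat \<Rightarrow> real" where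
  "unit_at j = (\<lambda>i. if i = j then 1 else 0)"

text \<open>
  The dilation of the standard simplex on \<open>B\<close> by the factor \<open>card B + 1\<close>, translated by the vector
  with all entries -1, which moves its only interior lattice point to the origin.
\<close>

definition dilated_simplex_vertices :: "nat set \<Rightarrow> (nat \<Rightarrow> real) set" where
  "dilated_simplex_vertices B =
     insert (- ones B) ((\<lambda>j. (real (card B) + 1) *\<^sub>R unit_at j - ones B) ` B)"

definition fano_simplex_vertices :: "nat set \<Rightarrow> (nat \<Rightarrow> real) set" where
  "fano_simplex_vertices B = insert (ones B) ((\<lambda>j. - unit_at j) ` B)"

lemma dot_ones: "dot B (ones B) x = sum x B"
  by (simp add: dot_def ones_def)

lemma dot_unit_at: "finite B \<Longrightarrow> j \<in> B \<Longrightarrow> dot B (unit_at j) x = x j"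
  using dot_unit[of B j x 1] by (simp add: unit_at_def dot_commute[of B x])

lemma fano_simplex_le_iff:
  assumes "finite B"
  shows "(\<forall>w\<in>fano_simplex_vertices B. dot B w x \<le> t) \<longleftrightarrow> sum x B \<le> t \<and> (\<forall>j\<in>B. - x j \<le> t)"
  using assms by (auto simp: fano_simplex_vertices_def dot_ones dot_minus_left dot_unit_at)

lemma dilated_simplex_le_iff:
  assumes "finite B"
  shows "(\<forall>v\<in>dilated_simplex_vertices B. dot B v x \<le> t) \<longleftrightarrow>
    - sum x B \<le> t \<and> (\<forall>j\<in>B. (real (card B) + 1) * x j - sum x B \<le> t)"
  using assms by (simp add: dilated_simplex_vertices_def dot_ones dot_minus_left dot_diff_left
    dot_scaleR_left dot_unit_at)

text \<open>
  Write \<open>v\<^sub>j\<close> and \<open>w\<^sub>j\<close> for the two families of \<open>N = card B + 1\<close> vectors.  Both sum to 0, and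
  \<open>\<langle>w\<^sub>i, v\<^sub>j\<rangle>\<close> is 1 for \<open>i \<noteq> j\<close> and \<open>1 - N\<close> for \<open>i = j\<close>.  Therefore \<open>N x = \<Sum>(1 - \<langle>w\<^sub>j, x\<rangle>) v\<^sub>j\<close> for
  every \<open>x\<close>, so the barycentric coordinates of \<open>x\<close> in one simplex are, up to the factor \<open>1 / N\<close>, the
  slacks in its facet inequalities; the same holds with the families exchanged.
\<close>

lemma reflexive_pair_simplex:
  assumes fin: "finite B"
  shows "reflexive_pair B (dilated_simplex_vertices B) (fano_simplex_vertices B)"
proof -
  let ?V = "dilated_simplex_vertices B" and ?W = "fano_simplex_vertices B"
  define N where "N = real (card B) + 1"
  have N: "N > 0" unfolding N_def by (simp add: add_nonneg_pos)
  \<comment> \<open>z indexes the vector of either family that belongs to no coordinate\<close>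
  obtain z where z: "z \<notin> B" using fin infinite_UNIV_nat ex_new_if_finite by blast
  have sum_if: "(\<Sum>j\<in>B. c j * (if i = j then s else 0)) = (if i \<in> B then c i * s else 0)" 
    for c :: "nat \<Rightarrow> real" and i s
    using fin by (simp add: if_distrib cong: if_cong)
  have polarW: "polar B ?W = {x \<in> coord_space B. sum x B \<le> 1 \<and> (\<forall>j\<in>B. - x j \<le> 1)}"
    unfolding polar_def fano_simplex_le_iff[OF fin] ..
  have polarV: "polar B ?V = {x \<in> coord_space B. - sum x B \<le> 1 \<and> (\<forall>j\<in>B. N * x j - sum x B \<le> 1)}"
    unfolding polar_def dilated_simplex_le_iff[OF fin] N_def ..
  have sum_ones: "sum (ones B) B = N - 1" by (simp add: ones_def N_def)
  have sum_unit: "sum (unit_at j) B = 1" if "j \<in> B" for j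
    using fin that by (simp add: unit_at_def)
  have "?V \<subseteq> polar B ?W"
  proof
    fix v assume "v \<in> ?V"
    then consider "v = - ones B" | j where "j \<in> B" "v = N *\<^sub>R unit_at j - ones B"
      unfolding dilated_simplex_vertices_def N_def by blast
    then show "v \<in> polar B ?W"
    proof cases
      case 1
      then show ?thesis using sum_ones N
        by (simp add: polarW coord_space_def sum_negf) (simp add: ones_def)
    next
      case 2
      have "sum v B = 1"
        using 2 sum_ones sum_unit[of j] by (simp add: sum_subtractf sum_distrib_left[symmetric])
      with 2 show ?thesis using N
        by (auto simp: polarW coord_space_def ones_def unit_at_def)
    qed
  qed
  then have 1: "convex hull ?V \<subseteq> polar B ?W" by (simp add: hull_minimal convex_polar)
  have "?W \<subseteq> polar B ?V"
  proof
    fix w assume "w \<in> ?W"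
    then consider "w = ones B" | j where "j \<in> B" "w = - unit_at j"
      unfolding fano_simplex_vertices_def by blast
    then show "w \<in> polar B ?V"
    proof cases
      case 1
      then show ?thesis using sum_ones N
        by (simp add: polarV coord_space_def) (simp add: ones_def)
    next
      case 2
      have "sum w B = - 1"
        using 2 sum_unit[of j] by (simp add: sum_negf)
      with 2 show ?thesis using N
        by (auto simp: polarV coord_space_def unit_at_def)
    qed
  qed
  then have 2: "convex hull ?W \<subseteq> polar B ?V" by (simp add: hull_minimal convex_polar)
  have 3: "polar B ?W \<subseteq> convex hull ?V"
  proof
    fix x assume "x \<in> polar B ?W"
    then have x: "x \<in> coord_space B" "sum x B \<le> 1" "\<And>j. j \<in> B \<Longrightarrow> - x j \<le> 1"
      by (auto simp: polarW)
    \<comment> \<open>the slacks of x in the facet inequalities, divided by N\<close>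
    define c where "c = (\<lambda>j. if j = z then (1 - sum x B) / N else (1 + x j) / N)"
    define y where "y = (\<lambda>j. if j = z then - ones B else N *\<^sub>R unit_at j - ones B)"
    have cB: "c j = (1 + x j) / N" and yB: "y j = N *\<^sub>R unit_at j - ones B" if "j \<in> B" for j
      using that z by (auto simp: c_def y_def)
    have sumcB: "sum c B = (N - 1 + sum x B) / N"
      using cB by (simp add: sum_divide_distrib[symmetric] sum.distrib N_def)
    have "(\<Sum>j\<in>insert z B. c j *\<^sub>R y j) \<in> convex hull ?V"
    proof (intro convex_sum convex_convex_hull)
      show "sum c (insert z B) = 1"
        using fin z N sumcB by (simp add: c_def add_divide_distrib[symmetric])
      show "0 \<le> c j" if "j \<in> insert z B" for j
        using that x N by (force simp: c_def)
      show "y j \<in> convex hull ?V" if "j \<in> insert z B" for j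
        using that by (intro hull_inc) (auto simp: y_def dilated_simplex_vertices_def N_def)
    qed (use fin in simp)
    also have "(\<Sum>j\<in>insert z B. c j *\<^sub>R y j) = x"
    proof
      fix i
      have "(\<Sum>j\<in>insert z B. c j *\<^sub>R y j) i = - c z * ones B i + (\<Sum>j\<in>B. c j * (N * unit_at j i - ones B i))"
        unfolding sum_fun_apply using fin z yB by (simp add: y_def)
      also have "\<dots> = N * (\<Sum>j\<in>B. c j * unit_at j i) - (c z + sum c B) * ones B i"
        by (simp add: algebra_simps sum_subtractf sum_distrib_left sum_distrib_right)
      also have "c z + sum c B = 1"
        using N sumcB by (simp add: c_def add_divide_distrib[symmetric])
      also have "N * (\<Sum>j\<in>B. c j * unit_at j i) - 1 * ones B i = x i"
        using x(1) N cB[of i] by (auto simp: unit_at_def sum_if ones_def coord_space_def)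
      finally show "(\<Sum>j\<in>insert z B. c j *\<^sub>R y j) i = x i" .
    qed
    finally show "x \<in> convex hull ?V" .
  qed
  have 4: "polar B ?V \<subseteq> convex hull ?W"
  proof
    fix x assume "x \<in> polar B ?V"
    then have x: "x \<in> coord_space B" "- sum x B \<le> 1" "\<And>j. j \<in> B \<Longrightarrow> N * x j - sum x B \<le> 1"
      by (auto simp: polarV)
    \<comment> \<open>again the slacks divided by N, now in the inequalities given by the vertices of the other simplex\<close>
    define c where "c = (\<lambda>j. if j = z then (1 + sum x B) / N else (1 - N * x j + sum x B) / N)"
    define y where "y = (\<lambda>j. if j = z then ones B else - unit_at j)"
    have cB: "c j = (1 - N * x j + sum x B) / N" and yB: "y j = - unit_at j" if "j \<in> B" for j
      using that z by (auto simp: c_def y_def)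
    have "sum c B = (\<Sum>j\<in>B. (1 - N * x j + sum x B) / N)"
      by (intro sum.cong) (simp_all add: cB)
    also have "\<dots> = ((N - 1) - N * sum x B + (N - 1) * sum x B) / N"
      by (simp add: sum_divide_distrib[symmetric] sum.distrib sum_subtractf sum_distrib_left N_def)
    finally have sumcB: "sum c B = (N - 1 - sum x B) / N"
      by (simp add: algebra_simps)
    have "(\<Sum>j\<in>insert z B. c j *\<^sub>R y j) \<in> convex hull ?W"
    proof (intro convex_sum convex_convex_hull)
      show "sum c (insert z B) = 1"
        using fin z N sumcB by (simp add: c_def add_divide_distrib[symmetric])
      show "0 \<le> c j" if "j \<in> insert z B" for j
        using that x N by (force simp: c_def)
      show "y j \<in> convex hull ?W" if "j \<in> insert z B" for j
        using that by (intro hull_inc) (auto simp: y_def fano_simplex_vertices_def)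
    qed (use fin in simp)
    also have "(\<Sum>j\<in>insert z B. c j *\<^sub>R y j) = x"
    proof
      fix i
      have "(\<Sum>j\<in>insert z B. c j *\<^sub>R y j) i = c z * ones B i - (\<Sum>j\<in>B. c j * unit_at j i)"
        unfolding sum_fun_apply using fin z yB by (simp add: y_def sum_negf)
      also have "\<dots> = x i"
        using x(1) N cB[of i]
        by (auto simp: unit_at_def sum_if ones_def coord_space_def c_def diff_divide_distrib[symmetric])
      finally show "(\<Sum>j\<in>insert z B. c j *\<^sub>R y j) i = x i" .
    qed
    finally show "x \<in> convex hull ?W" .
  qed
  have "integer_point v" if "v \<in> ?V \<union> ?W" for v
    using that by (auto simp: dilated_simplex_vertices_def fano_simplex_vertices_def integer_point_def
      ones_def unit_at_def)
  with 1 2 3 4 show ?thesis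
    using fin unfolding reflexive_pair_def
    by (auto simp: dilated_simplex_vertices_def fano_simplex_vertices_def)
qed

section \<open>Lattice points in the two simplices\<close>

text \<open>
  The functions are 0 outside \<open>C\<close> so that each family on \<open>C\<close> is represented by one function only.
\<close>

definition bounded_sums :: "nat set \<Rightarrow> nat \<Rightarrow> (nat \<Rightarrow> nat) set" where
  "bounded_sums C M = {f. (\<forall>i. i \<notin> C \<longrightarrow> f i = 0) \<and> sum f C \<le> M}"

text \<open>
  Fixing the value at one point of \<open>C\<close> reduces the count to a rising sum of binomial coefficients.
\<close>

lemma card_bounded_sums:
  assumes "finite C"
  shows "finite (bounded_sums C M) \<and> card (bounded_sums C M) = (M + card C) choose card C"
  using assms
proof (induction C arbitrary: M)
  case empty
  have "bounded_sums {} M = {\<lambda>_. 0}" by (auto simp: bounded_sums_def)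
  then show ?case by simp
next
  case (insert b C)
  let ?S = "Sigma {..M} (\<lambda>k. bounded_sums C (M - k))"
  have sum_upd: "(\<Sum>i\<in>C. if i = b then k else g i) = sum g C" for g :: "nat \<Rightarrow> nat" and k
    using insert.hyps by (intro sum.cong) auto
  have bij: "bij_betw (\<lambda>(k, g). g(b := k)) ?S (bounded_sums (insert b C) M)"
  proof (rule bij_betw_byWitness[where f' = "\<lambda>f. (f b, f(b := 0))"])
    show "\<forall>a\<in>?S. (\<lambda>f. (f b, f(b := 0))) ((\<lambda>(k, g). g(b := k)) a) = a"
      using insert.hyps by (auto simp: bounded_sums_def fun_eq_iff)
    show "(\<lambda>(k, g). g(b := k)) ` ?S \<subseteq> bounded_sums (insert b C) M"
      using insert.hyps by (auto simp: bounded_sums_def sum_upd)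
    show "(\<lambda>f. (f b, f(b := 0))) ` bounded_sums (insert b C) M \<subseteq> ?S"
      using insert.hyps by (auto simp: bounded_sums_def sum_upd)
  qed auto
  have fin: "finite ?S" using insert.IH by auto
  then have finb: "finite (bounded_sums (insert b C) M)"
    using bij bij_betw_finite by blast
  have "card (bounded_sums (insert b C) M) = card ?S"
    using bij bij_betw_same_card by metis
  also have "\<dots> = (\<Sum>k\<le>M. (M - k + card C) choose card C)"
    using insert.IH by simp
  also have "\<dots> = (\<Sum>k\<le>M. (card C + k) choose card C)"
    by (rule sum.reindex_bij_witness[of _ "\<lambda>k. M - k" "\<lambda>k. M - k"]) (auto simp: add.commute)
  also have "\<dots> = (M + card (insert b C)) choose card (insert b C)"
    using insert.hyps choose_rising_sum(1)[of "card C" M] by (simp add: add.commute)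
  finally show ?case using finb by simp
qed

text \<open>
  Adding \<open>n\<close> to every coordinate turns the lattice points of the \<open>n\<close>-th dilation into the families of
  natural numbers with sum at most \<open>n + card B * n\<close>.
\<close>

lemma ehrhart_count_dilated_simplex:
  assumes fin: "finite B"
  shows "ehrhart_count (convex hull (dilated_simplex_vertices B)) n =
    ((card B + 1) * n + card B) choose card B"
proof -
  let ?L = "{x \<in> coord_space B. (\<forall>w\<in>fano_simplex_vertices B. dot B w x \<le> real n) \<and> integer_point x}"
  have L: "?L = {x \<in> coord_space B. sum x B \<le> n \<and> (\<forall>j\<in>B. - x j \<le> n) \<and> integer_point x}"
    unfolding fano_simplex_le_iff[OF fin] by blast
  have "bij_betw (\<lambda>f i. if i \<in> B then real (f i) - real n else 0)
      (bounded_sums B ((card B + 1) * n)) ?L"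
    unfolding L
  proof (rule bij_betw_byWitness[where f' = "\<lambda>x i. if i \<in> B then nat \<lfloor>x i + real n\<rfloor> else 0"])
    show "(\<lambda>f i. if i \<in> B then real (f i) - real n else 0) ` bounded_sums B ((card B + 1) * n)
      \<subseteq> {x \<in> coord_space B. sum x B \<le> n \<and> (\<forall>j\<in>B. - x j \<le> n) \<and> integer_point x}"
    proof safe
      fix f assume "f \<in> bounded_sums B ((card B + 1) * n)"
      then have "sum f B \<le> (card B + 1) * n" by (simp add: bounded_sums_def)
      then have "real (sum f B) \<le> real ((card B + 1) * n)" by (rule of_nat_mono)
      then show "(\<Sum>i\<in>B. if i \<in> B then real (f i) - real n else 0) \<le> real n"
        by (simp add: sum_subtractf algebra_simps)
    qed (auto simp: coord_space_def integer_point_def)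
    show "(\<lambda>x i. if i \<in> B then nat \<lfloor>x i + real n\<rfloor> else 0) `
        {x \<in> coord_space B. sum x B \<le> n \<and> (\<forall>j\<in>B. - x j \<le> n) \<and> integer_point x}
      \<subseteq> bounded_sums B ((card B + 1) * n)"
    proof safe
      fix x :: "nat \<Rightarrow> real" assume x: "sum x B \<le> n" "\<forall>j\<in>B. - x j \<le> n" "integer_point x"
      have "real (\<Sum>i\<in>B. nat \<lfloor>x i + real n\<rfloor>) = (\<Sum>i\<in>B. x i + n)"
        unfolding of_nat_sum
      proof (rule sum.cong)
        fix i assume "i \<in> B"
        then have "0 \<le> x i + n" using x(2) by force
        then show "real (nat \<lfloor>x i + real n\<rfloor>) = x i + n"
          using x(3) by (auto simp: integer_point_def elim!: allE[of _ i] Ints_cases)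
      qed simp
      also have "\<dots> \<le> real ((card B + 1) * n)"
        using x(1) by (simp add: sum.distrib algebra_simps)
      finally have "(\<Sum>i\<in>B. nat \<lfloor>x i + real n\<rfloor>) \<le> (card B + 1) * n" by (simp only: of_nat_le_iff)
      then show "(\<lambda>i. if i \<in> B then nat \<lfloor>x i + real n\<rfloor> else 0) \<in> bounded_sums B ((card B + 1) * n)"
        by (simp add: bounded_sums_def)
    qed
    show "\<forall>f\<in>bounded_sums B ((card B + 1) * n). (\<lambda>i. if i \<in> B then
        nat \<lfloor>(if i \<in> B then real (f i) - real n else 0) + real n\<rfloor> else 0) = f"
      by (auto simp: bounded_sums_def fun_eq_iff)
    show "\<forall>x\<in>{x \<in> coord_space B. sum x B \<le> n \<and> (\<forall>j\<in>B. - x j \<le> n) \<and> integer_point x}.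
       (\<lambda>i. if i \<in> B then real (if i \<in> B then nat \<lfloor>x i + real n\<rfloor> else 0) - real n else 0) = x"
    proof (intro ballI ext)
      fix x :: "nat \<Rightarrow> real" and i assume x: "x \<in> {x \<in> coord_space B. sum x B \<le> n \<and> (\<forall>j\<in>B. - x j \<le> n) \<and> integer_point x}"
      show "(if i \<in> B then real (if i \<in> B then nat \<lfloor>x i + real n\<rfloor> else 0) - real n else 0) = x i"
      proof (cases "i \<in> B")
        case True
        then have "0 \<le> x i + n" using x by force
        then show ?thesis using True x by (auto simp: integer_point_def elim!: allE[of _ i] Ints_cases)
      qed (use x in \<open>simp add: coord_space_def\<close>)
    qed
  qed
  then have "card (bounded_sums B ((card B + 1) * n)) = card ?L" by (rule bij_betw_same_card)
  also have "\<dots> = ehrhart_count (convex hull (dilated_simplex_vertices B)) n"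
    by (rule ehrhart_count_reflexive_pair[OF reflexive_pair_simplex[OF fin], symmetric])
  finally show ?thesis using card_bounded_sums[OF fin] by simp
qed

text \<open>
  Subtracting 1 everywhere reduces positive families to arbitrary ones with a smaller bound.
\<close>

lemma card_positive_bounded_sums:
  assumes "finite C"
  shows "card {f \<in> bounded_sums C n. \<forall>i\<in>C. f i \<ge> 1} = n choose card C"
proof (cases "card C \<le> n")
  case False
  have "{f \<in> bounded_sums C n. \<forall>i\<in>C. f i \<ge> 1} = {}"
  proof safe
    fix f assume f: "f \<in> bounded_sums C n" "\<forall>i\<in>C. f i \<ge> 1"
    then have "card C \<le> sum f C" using sum_mono[of C "\<lambda>_. 1" f] by simp
    with f False show "f \<in> {}" by (simp add: bounded_sums_def)
  qed
  then show ?thesis using False by (simp only: card.empty) (simp add: binomial_eq_0)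
next
  case True
  have "bij_betw (\<lambda>f i. if i \<in> C then f i + 1 else 0) (bounded_sums C (n - card C))
      {f \<in> bounded_sums C n. \<forall>i\<in>C. f i \<ge> 1}"
  proof (rule bij_betw_byWitness[where f' = "\<lambda>f i. f i - 1"])
    show "(\<lambda>f i. if i \<in> C then f i + 1 else 0) ` bounded_sums C (n - card C)
        \<subseteq> {f \<in> bounded_sums C n. \<forall>i\<in>C. f i \<ge> 1}"
      using True by (auto simp: bounded_sums_def sum.distrib sum_Suc)
    show "(\<lambda>f i. f i - 1) ` {f \<in> bounded_sums C n. \<forall>i\<in>C. f i \<ge> 1} \<subseteq> bounded_sums C (n - card C)"
      using True by (auto simp: bounded_sums_def sum_subtractf_nat)
    show "\<forall>f\<in>bounded_sums C (n - card C). (\<lambda>i. (if i \<in> C then f i + 1 else 0) - 1) = f"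
      by (auto simp: bounded_sums_def fun_eq_iff)
    show "\<forall>f\<in>{f \<in> bounded_sums C n. \<forall>i\<in>C. f i \<ge> 1}. (\<lambda>i. if i \<in> C then f i - 1 + 1 else 0) = f"
      by (auto simp: bounded_sums_def fun_eq_iff)
  qed
  then show ?thesis
    using bij_betw_same_card card_bounded_sums[OF assms, of "n - card C"] True by fastforce
qed

text \<open>
  The lattice points of the \<open>n\<close>-th dilation correspond to the coefficient families \<open>f\<close> on \<open>C\<close> with sum
  at most \<open>n\<close> that vanish somewhere: \<open>C\<close> is \<open>B\<close> with an index \<open>z\<close> for the vertex \<open>\<Sum>e\<^sub>j\<close> added, and the
  combination of the vertices with coefficients \<open>f\<close> has the coordinates \<open>f z - f j\<close>.  The count is
  stated additively, the families vanishing nowhere being the second summand.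
\<close>

lemma ehrhart_count_fano_simplex:
  assumes fin: "finite B"
  shows "ehrhart_count (convex hull (fano_simplex_vertices B)) n + (n choose (card B + 1)) =
    (n + card B + 1) choose (card B + 1)"
proof -
  obtain z where z: "z \<notin> B" using fin infinite_UNIV_nat ex_new_if_finite by blast
  define C where "C = insert z B"
  have C: "finite C" "card C = card B + 1" "C \<noteq> {}" using fin z by (auto simp: C_def)
  define N where "N = real (card B) + 1"
  have N: "N = real (card C)" using C by (simp add: N_def)
  let ?L = "{x \<in> coord_space B. (\<forall>v\<in>dilated_simplex_vertices B. dot B v x \<le> real n) \<and> integer_point x}"
  have xz: "x z = 0" "sum x B = sum x C" if "x \<in> coord_space B" for x
    using that z fin by (simp_all add: coord_space_def C_def)
  \<comment> \<open>with the convention x z = 0, all facet inequalities take the same form\<close>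
  have L: "?L = {x \<in> coord_space B. (\<forall>j\<in>C. N * x j - sum x C \<le> n) \<and> integer_point x}"
  proof -
    have "(- sum x B \<le> n \<and> (\<forall>j\<in>B. N * x j - sum x B \<le> n)) = (\<forall>j\<in>C. N * x j - sum x C \<le> n)"
      if "x \<in> coord_space B" for x
      unfolding xz(2)[OF that, symmetric] using xz(1)[OF that] by (simp add: C_def)
    then show ?thesis unfolding dilated_simplex_le_iff[OF fin] N_def by blast
  qed
  define F where "F = {f \<in> bounded_sums C n. \<exists>i\<in>C. f i = 0}"
  define \<phi> where "\<phi> = (\<lambda>f i. if i \<in> B then real (f z) - real (f i) else 0)"
  have \<phi>C: "\<phi> f i = real (f z) - real (f i)" if "i \<in> C" for f i
    using that by (auto simp: \<phi>_def C_def)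
  have "inj_on \<phi> F"
  proof (rule inj_onI, rule ext)
    fix f g i assume f: "f \<in> F" and g: "g \<in> F" and eq: "\<phi> f = \<phi> g"
    have c: "real (f j) - real (g j) = real (f z) - real (g z)" if "j \<in> C" for j
      using fun_cong[OF eq, of j] \<phi>C[OF that] by simp
    obtain j j' where "j \<in> C" "f j = 0" "j' \<in> C" "g j' = 0" using f g by (auto simp: F_def)
    with c[of j] c[of j'] have "f z = g z" by simp
    then show "f i = g i"
      using c[of i] f g by (cases "i \<in> C") (auto simp: F_def bounded_sums_def)
  qed
  then have "card F = card (\<phi> ` F)" by (rule card_image[symmetric])
  also have "\<phi> ` F = ?L"
    unfolding L
  proof (intro equalityI subsetI)
    fix x assume "x \<in> \<phi> ` F"
    then obtain f where f: "f \<in> F" "x = \<phi> f" by blast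
    then have le: "real (sum f C) \<le> real n"
      unfolding of_nat_le_iff by (simp add: F_def bounded_sums_def)
    have "sum x C = (\<Sum>i\<in>C. real (f z) - real (f i))"
      using f \<phi>C by (intro sum.cong) auto
    also have "\<dots> = N * f z - sum f C" by (simp add: sum_subtractf N)
    finally have sumx: "sum x C = N * f z - sum f C" .
    have "N * x j - sum x C \<le> n" if "j \<in> C" for j
    proof -
      have "N * x j = N * f z - N * f j"
        using f \<phi>C[OF that] by (simp only: right_diff_distrib)
      then have "N * x j - sum x C = sum f C - N * f j"
        using sumx by simp
      then show ?thesis using le by (simp add: N add_increasing2 diff_le_eq)
    qed
    moreover have "x \<in> coord_space B" "integer_point x"
      using f by (auto simp: \<phi>_def coord_space_def integer_point_def)
    ultimately show "x \<in> {x \<in> coord_space B. (\<forall>j\<in>C. N * x j - sum x C \<le> n) \<and> integer_point x}"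
      by blast
  next
    fix x assume "x \<in> {x \<in> coord_space B. (\<forall>j\<in>C. N * x j - sum x C \<le> n) \<and> integer_point x}"
    then have x: "x \<in> coord_space B" "\<And>j. j \<in> C \<Longrightarrow> N * x j - sum x C \<le> n" "integer_point x" by auto
    \<comment> \<open>the smallest shift making all coefficients mu - x i nonnegative; by minimality one of them is 0\<close>
    define mu where "mu = Max (x ` C)"
    have mu: "x j \<le> mu" if "j \<in> C" for j using that C unfolding mu_def by simp
    have "mu \<in> x ` C" unfolding mu_def using C by (intro Max_in) auto
    then obtain j0 where j0: "j0 \<in> C" "mu = x j0" by blast
    define f where "f = (\<lambda>i. if i \<in> C then nat \<lfloor>mu - x i\<rfloor> else 0)"
    have f: "real (f i) = mu - x i" if "i \<in> C" for i
    proof -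
      have "mu - x i \<in> \<int>" using x(3) j0 by (simp add: integer_point_def)
      then show ?thesis using mu[OF that] that by (auto simp: f_def elim!: Ints_cases)
    qed
    have "real (sum f C) = (\<Sum>i\<in>C. mu - x i)" using f by simp
    also have "\<dots> = N * x j0 - sum x C" by (simp add: sum_subtractf N j0)
    also have "\<dots> \<le> n" using x(2) j0 by blast
    finally have "sum f C \<le> n" by (simp only: of_nat_le_iff)
    moreover have "f j0 = 0" "\<forall>i. i \<notin> C \<longrightarrow> f i = 0" by (simp_all add: f_def j0)
    ultimately have "f \<in> F" using j0 by (auto simp: F_def bounded_sums_def)
    moreover have "\<phi> f = x"
    proof
      fix i show "\<phi> f i = x i"
        using f[of i] f[of z] xz(1)[OF x(1)] x(1) by (auto simp: \<phi>_def C_def coord_space_def)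
    qed
    ultimately show "x \<in> \<phi> ` F" by blast
  qed
  also have "card ?L = ehrhart_count (convex hull (fano_simplex_vertices B)) n"
    by (rule ehrhart_count_reflexive_pair[OF reflexive_pair_sym[OF reflexive_pair_simplex[OF fin]], symmetric])
  finally have "card F = ehrhart_count (convex hull (fano_simplex_vertices B)) n" .
  moreover have "card F + card {f \<in> bounded_sums C n. \<forall>i\<in>C. f i \<ge> 1} = card (bounded_sums C n)"
  proof -
    have "bounded_sums C n = F \<union> {f \<in> bounded_sums C n. \<forall>i\<in>C. f i \<ge> 1}"
      unfolding F_def by (auto simp: Suc_le_eq)
    moreover have "F \<inter> {f \<in> bounded_sums C n. \<forall>i\<in>C. f i \<ge> 1} = {}"
      by (force simp: F_def)
    moreover have "finite F" using card_bounded_sums[OF C(1)] by (simp add: F_def)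
    moreover have "finite (bounded_sums C n)" using card_bounded_sums[OF C(1)] by blast
    ultimately show ?thesis
      using card_Un_disjoint[of F "{f \<in> bounded_sums C n. \<forall>i\<in>C. f i \<ge> 1}"] by simp
  qed
  ultimately show ?thesis
    using card_positive_bounded_sums[OF C(1), of n] card_bounded_sums[OF C(1), of n] C(2)
    by (simp add: add.assoc)
qed

section \<open>The two Ehrhart polynomials and their roots\<close>

definition dilated_simplex_poly :: "nat \<Rightarrow> complex poly" where
  "dilated_simplex_poly m = smult (1 / fact m) (\<Prod>i=1..m. [:of_nat i, of_nat (m + 1):])"

definition fano_simplex_poly :: "nat \<Rightarrow> complex poly" where
  "fano_simplex_poly l = smult (1 / fact (Suc l))
     ((\<Prod>i<Suc l. [:of_nat (i + 1), 1:]) - (\<Prod>i<Suc l. [:- of_nat i, 1:]))"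

lemma prod_rising_eq_binomial:
  "(\<Prod>i=1..m. of_nat a + of_nat i :: complex) = fact m * of_nat ((a + m) choose m)"
proof -
  have "(\<Prod>i=1..m. of_nat a + of_nat i :: complex) = (\<Prod>i=0..<m. of_nat (a + m) - of_nat i)"
    by (rule prod.reindex_bij_witness[of _ "\<lambda>i. m - i" "\<lambda>i. m - i"]) (auto simp: of_nat_diff)
  then show ?thesis
    by (simp add: binomial_gbinomial gbinomial_prod_rev)
qed

lemma prod_falling_eq_binomial:
  "(\<Prod>i<m. of_nat n - of_nat i :: complex) = fact m * of_nat (n choose m)"
  by (simp add: binomial_gbinomial gbinomial_prod_rev atLeast0LessThan)

lemma poly_dilated_simplex_poly:
  "poly (dilated_simplex_poly m) (of_nat n) = of_nat (((m + 1) * n + m) choose m)"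
proof -
  have "poly (dilated_simplex_poly m) (of_nat n)
      = (\<Prod>i=1..m. of_nat ((m + 1) * n) + of_nat i) / fact m"
    by (simp add: dilated_simplex_poly_def poly_prod algebra_simps)
  then show ?thesis unfolding prod_rising_eq_binomial by simp
qed

lemma poly_fano_simplex_poly:
  "poly (fano_simplex_poly l) (of_nat n) =
     of_nat ((n + l + 1) choose (l + 1)) - of_nat (n choose (l + 1))"
proof -
  have "(\<Prod>i<Suc l. of_nat (i + 1) + of_nat n :: complex) = (\<Prod>i=1..Suc l. of_nat n + of_nat i)"
    by (rule prod.reindex_bij_witness[of _ "\<lambda>i. i - 1" Suc]) auto
  moreover have "(\<Prod>i<Suc l. - of_nat i + of_nat n :: complex) = (\<Prod>i<Suc l. of_nat n - of_nat i)"
    by simp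
  ultimately show ?thesis
    unfolding prod_rising_eq_binomial prod_falling_eq_binomial fano_simplex_poly_def
    by (simp add: poly_prod diff_divide_distrib[symmetric] right_diff_distrib[symmetric] del: prod.lessThan_Suc fact_Suc)
qed

lemma dilated_simplex_poly_roots:
  "{z. poly (dilated_simplex_poly m) z = 0} = (\<lambda>i. complex_of_real (- (real i / real (m + 1)))) ` {1..m}"
proof -
  have eq: "of_nat i + z * of_nat (m + 1) = 0 \<longleftrightarrow> z = complex_of_real (- (real i / real (m + 1)))" for i z
  proof -
    have nz: "(of_nat (m + 1) :: complex) \<noteq> 0" using of_nat_neq_0 by simp
    have "of_nat i + z * of_nat (m + 1) = 0 \<longleftrightarrow> z * of_nat (m + 1) = - of_nat i"
      by (metis add.commute add_eq_0_iff2)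
    also have "\<dots> \<longleftrightarrow> z = - (of_nat i / of_nat (m + 1))"
      using nz by (metis minus_divide_left nonzero_eq_divide_eq)
    finally show ?thesis by simp
  qed
  have "poly (dilated_simplex_poly m) z = 0 \<longleftrightarrow> (\<exists>i\<in>{1..m}. of_nat i + z * of_nat (m + 1) = 0)" for z
    by (auto simp: dilated_simplex_poly_def poly_prod)
  then show ?thesis unfolding eq by auto
qed

lemma card_dilated_simplex_poly_roots: "card {z. poly (dilated_simplex_poly m) z = 0} = m"
proof -
  have "inj_on (\<lambda>i. complex_of_real (- (real i / real (m + 1)))) {1..m}"
    by (rule inj_onI) (simp only: of_real_eq_iff neg_equal_iff_equal divide_cancel_right, auto)
  then show ?thesis unfolding dilated_simplex_poly_roots by (simp only: card_image) simp
qed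

text \<open>
  The difference of two such products loses its leading term, so its degree is read off from the next
  coefficient.
\<close>

lemma prod_linear_coeffs:
  fixes c :: "nat \<Rightarrow> 'a :: comm_ring_1"
  shows "degree (\<Prod>i<n. [:c i, 1:]) \<le> n" "coeff (\<Prod>i<n. [:c i, 1:]) n = 1"
    "coeff (\<Prod>i<Suc n. [:c i, 1:]) n = (\<Sum>i<Suc n. c i)"
proof -
  have 1: "degree (\<Prod>i<n. [:c i, 1:]) \<le> n \<and> coeff (\<Prod>i<n. [:c i, 1:]) n = 1" for n
  proof (induction n)
    case (Suc n)
    have "coeff (\<Prod>i<n. [:c i, 1:]) (Suc n) = 0"
      using Suc by (intro coeff_eq_0) simp
    moreover have "degree ([:c n, 1:] * (\<Prod>i<n. [:c i, 1:])) \<le> degree [:c n, 1:] + n"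
      using degree_mult_le Suc by (meson add_left_mono order_trans)
    ultimately show ?case using Suc by (simp add: mult.commute)
  qed simp
  then show "degree (\<Prod>i<n. [:c i, 1:]) \<le> n" "coeff (\<Prod>i<n. [:c i, 1:]) n = 1" by auto
  show "coeff (\<Prod>i<Suc n. [:c i, 1:]) n = (\<Sum>i<Suc n. c i)"
  proof (induction n)
    case (Suc n)
    have "(\<Prod>i<Suc (Suc n). [:c i, 1:]) = [:c (Suc n), 1:] * (\<Prod>i<Suc n. [:c i, 1:])"
      by (simp add: mult.commute)
    then show ?case using Suc 1[of "Suc n"] by (simp add: add.commute del: prod.lessThan_Suc)
  qed simp
qed

lemma degree_fano_simplex_poly: "degree (fano_simplex_poly l) = l"
proof -
  let ?f = "\<Prod>i<Suc l. [:of_nat (i + 1), 1:] :: complex poly"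
  let ?g = "\<Prod>i<Suc l. [:- of_nat i, 1:] :: complex poly"
  have "degree (?f - ?g) \<le> Suc l"
    by (intro degree_diff_le prod_linear_coeffs)
  moreover have "coeff (?f - ?g) (Suc l) = 0"
    unfolding coeff_diff prod_linear_coeffs(2) by simp
  ultimately have "degree (?f - ?g) \<le> l"
    using eq_zero_or_degree_less[of "?f - ?g" "Suc l"] by auto
  moreover have "coeff (?f - ?g) l = of_nat (\<Sum>i<Suc l. 2 * i + 1)"
    unfolding coeff_diff prod_linear_coeffs(3)
    by (simp add: sum_subtractf[symmetric] algebra_simps sum.distrib sum_negf sum_distrib_left del: sum.lessThan_Suc)
  then have "coeff (?f - ?g) l \<noteq> 0"
    by (simp only: of_nat_eq_0_iff) simp
  then have "l \<le> degree (?f - ?g)" by (rule le_degree)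
  ultimately have "degree (?f - ?g) = l" by (rule le_antisym)
  then show ?thesis by (simp add: fano_simplex_poly_def del: prod.lessThan_Suc fact_Suc)
qed

lemma fano_simplex_poly_root_iff:
  "poly (fano_simplex_poly l) z = 0 \<longleftrightarrow>
     (\<Prod>i<Suc l. of_nat (i + 1) + z) = (\<Prod>i<Suc l. - of_nat i + z)"
  by (simp add: fano_simplex_poly_def poly_prod del: prod.lessThan_Suc fact_Suc)

lemma norm_add_less_norm_add:
  assumes "\<bar>a + Re z\<bar> < \<bar>b + Re z\<bar>"
  shows "norm (complex_of_real a + z) < norm (complex_of_real b + z)"
proof -
  have "(a + Re z)\<^sup>2 < (b + Re z)\<^sup>2" using assms by (simp add: abs_le_square_iff[symmetric] not_le[symmetric])
  then show ?thesis by (simp add: cmod_def)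
qed

lemma prod_norm_strict_mono:
  fixes a b :: "nat \<Rightarrow> 'a :: real_normed_vector"
  assumes "\<And>i. norm (a i) < norm (b i)"
  shows "(\<Prod>i<Suc l. norm (a i)) < (\<Prod>i<Suc l. norm (b i))"
proof (rule prod_mono_strict[of 0])
  show "0 < norm (b i)" for i by (rule le_less_trans[OF norm_ge_zero assms])
qed (use assms less_imp_le in auto)

text \<open>
  At a root the products of \<open>z + i + 1\<close> and of \<open>z - i\<close> agree in modulus.  Off the line
  \<open>Re z = -1/2\<close>, which bisects \<open>-(i + 1)\<close> and \<open>i\<close> for every \<open>i\<close>, one product is larger factor by factor.
\<close>

lemma fano_simplex_poly_root_Re:
  assumes "poly (fano_simplex_poly l) z = 0"
  shows "Re z = - 1 / 2"
proof -
  have eq: "(\<Prod>i<Suc l. norm (of_nat (i + 1) + z)) = (\<Prod>i<Suc l. norm (- of_nat i + z))"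
    using assms unfolding fano_simplex_poly_root_iff prod_norm by simp
  have "\<not> Re z > - 1 / 2"
  proof
    assume *: "Re z > - 1 / 2"
    have lt: "norm (- of_nat i + z) < norm (of_nat (i + 1) + z)" for i
      using norm_add_less_norm_add[of "- real i" z "real (i + 1)"] * by simp
    have "(\<Prod>i<Suc l. norm (- of_nat i + z)) < (\<Prod>i<Suc l. norm (of_nat (i + 1) + z))"
      using lt by (rule prod_norm_strict_mono)
    with eq show False by simp
  qed
  moreover have "\<not> Re z < - 1 / 2"
  proof
    assume *: "Re z < - 1 / 2"
    have lt: "norm (of_nat (i + 1) + z) < norm (- of_nat i + z)" for i
      using norm_add_less_norm_add[of "real (i + 1)" z "- real i"] * by simp
    have "(\<Prod>i<Suc l. norm (of_nat (i + 1) + z)) < (\<Prod>i<Suc l. norm (- of_nat i + z))"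
      using lt by (rule prod_norm_strict_mono)
    with eq show False by simp
  qed
  ultimately show ?thesis by simp
qed

lemma poly_pderiv_prod_linear:
  fixes c :: "nat \<Rightarrow> 'a :: field"
  assumes "finite A" "\<And>i. i \<in> A \<Longrightarrow> c i + z \<noteq> 0"
  shows "poly (pderiv (\<Prod>i\<in>A. [:c i, 1:])) z = (\<Prod>i\<in>A. c i + z) * (\<Sum>i\<in>A. 1 / (c i + z))"
  using assms
proof (induction A)
  case (insert a A)
  then have "c a + z \<noteq> 0" by simp
  let ?q = "\<Prod>i\<in>A. [:c i, 1:]" and ?P = "\<Prod>i\<in>A. c i + z"
  have "poly ?q z = ?P" by (simp add: poly_prod)
  moreover have "poly (pderiv ?q) z = ?P * (\<Sum>i\<in>A. 1 / (c i + z))"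
    using insert by simp
  moreover have "(\<Prod>i\<in>insert a A. [:c i, 1:]) = [:c a, 1:] * ?q"
    using insert.hyps by simp
  ultimately have "poly (pderiv (\<Prod>i\<in>insert a A. [:c i, 1:])) z =
      (c a + z) * (?P * (\<Sum>i\<in>A. 1 / (c i + z))) + ?P"
    by (simp only: pderiv_mult poly_add poly_mult) (simp add: pderiv_pCons)
  also have "\<dots> = (c a + z) * ?P * (1 / (c a + z) + (\<Sum>i\<in>A. 1 / (c i + z)))"
    using \<open>c a + z \<noteq> 0\<close> by (simp add: distrib_left)
  finally show ?case using insert.hyps by simp
qed simp

text \<open>
  At a multiple root the two products have the same value and the same derivative, hence the same
  logarithmic derivative.  But on the line \<open>Re z = -1/2\<close> each \<open>1 / (z + i + 1)\<close> has positive real part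
  and each \<open>1 / (z - i)\<close> has negative real part.
\<close>

lemma fano_simplex_poly_simple_roots:
  assumes root: "poly (fano_simplex_poly l) z = 0"
  shows "poly (pderiv (fano_simplex_poly l)) z \<noteq> 0"
proof
  assume der: "poly (pderiv (fano_simplex_poly l)) z = 0"
  have Re: "Re z = - 1 / 2" using fano_simplex_poly_root_Re[OF root] .
  have pos: "Re (of_nat (i + 1) + z) > 0" and neg: "Re (- of_nat i + z) < 0" for i
    by (simp_all add: Re)
  have nz1: "of_nat (i + 1) + z \<noteq> 0" for i using pos[of i] by (metis less_irrefl zero_complex.sel(1))
  have nz2: "- of_nat i + z \<noteq> 0" for i using neg[of i] by (metis less_irrefl zero_complex.sel(1))
  define p where "p = (\<Prod>i<Suc l. of_nat (i + 1) + z)"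
  have p: "p \<noteq> 0" unfolding p_def using nz1 by (auto simp del: prod.lessThan_Suc of_nat_add)
  have p': "p = (\<Prod>i<Suc l. - of_nat i + z)"
    using root unfolding fano_simplex_poly_root_iff p_def .
  have "p * (\<Sum>i<Suc l. 1 / (of_nat (i + 1) + z)) = p * (\<Sum>i<Suc l. 1 / (- of_nat i + z))"
    using der nz1 nz2 poly_pderiv_prod_linear[of "{..<Suc l}" "\<lambda>i. of_nat (i + 1)" z]
      poly_pderiv_prod_linear[of "{..<Suc l}" "\<lambda>i. - of_nat i" z]
    unfolding p_def[symmetric] p'[symmetric] fano_simplex_poly_def pderiv_smult pderiv_diff
    by (simp del: prod.lessThan_Suc sum.lessThan_Suc of_nat_add of_nat_Suc fact_Suc) metis
  then have "(\<Sum>i<Suc l. 1 / (of_nat (i + 1) + z)) = (\<Sum>i<Suc l. 1 / (- of_nat i + z))"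
    using p by simp
  then have "(\<Sum>i<Suc l. Re (1 / (of_nat (i + 1) + z))) = (\<Sum>i<Suc l. Re (1 / (- of_nat i + z)))"
    by (metis (no_types, lifting) Re_sum sum.cong)
  moreover have "Re (1 / w) > 0" if "Re w > 0" for w
    using that by (auto simp: Re_divide' complex_eq_iff intro!: divide_pos_pos)
  then have "(\<Sum>i<Suc l. Re (1 / (of_nat (i + 1) + z))) > 0"
    using pos by (intro sum_pos) auto
  moreover have "Re (1 / w) \<le> 0" if "Re w < 0" for w
    using that by (auto simp: Re_divide' intro!: divide_nonpos_nonneg)
  then have "(\<Sum>i<Suc l. Re (1 / (- of_nat i + z))) \<le> 0"
    using neg by (intro sum_nonpos) blast
  ultimately show False by simp
qed

lemma card_fano_simplex_poly_roots: "card {z. poly (fano_simplex_poly l) z = 0} = l"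
proof -
  have "rsquarefree (fano_simplex_poly l)"
    unfolding rsquarefree_roots using fano_simplex_poly_simple_roots by blast
  then have "fano_simplex_poly l = smult (lead_coeff (fano_simplex_poly l))
      (\<Prod>z | poly (fano_simplex_poly l) z = 0. [:- z, 1:])"
    by (simp add: complex_poly_decompose_rsquarefree)
  moreover have "fano_simplex_poly l \<noteq> 0"
    using fano_simplex_poly_simple_roots[of l 0] by auto
  ultimately have "degree (fano_simplex_poly l) =
      degree (\<Prod>z | poly (fano_simplex_poly l) z = 0. [:- z, 1:])"
    by (metis degree_smult_eq leading_coeff_0_iff)
  then show ?thesis
    by (simp add: degree_fano_simplex_poly degree_prod_sum_eq)
qed

text \<open>
  At the only real point \<open>-1/2\<close> of the line, corresponding factors of the two products are negatives of
  each other, and the number \<open>l + 1\<close> of factors is odd.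
\<close>

lemma fano_simplex_poly_root_not_real:
  assumes "even l" "poly (fano_simplex_poly l) z = 0"
  shows "z \<notin> \<real>"
proof
  assume "z \<in> \<real>"
  then have z: "z = - 1 / 2"
    using fano_simplex_poly_root_Re[OF assms(2)] by (auto simp: complex_eq_iff complex_is_Real_iff)
  define p where "p = (\<Prod>i<Suc l. of_nat (i + 1) + z)"
  have "- of_nat i + z = - (of_nat (i + 1) + z)" for i by (simp add: z)
  then have "(\<Prod>i<Suc l. - of_nat i + z) = (- 1) ^ Suc l * p"
    unfolding p_def by (simp only: prod_uminus card_lessThan)
  then have "p = - p"
    using assms unfolding fano_simplex_poly_root_iff p_def[symmetric] by simp
  then have "p = 0" by simp
  then obtain i where "of_nat (i + 1) + z = 0" unfolding p_def by (auto simp del: prod.lessThan_Suc)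
  then have "Re (of_nat (i + 1) + z) = 0" by simp
  then show False by (simp add: z)
qed

section \<open>The product of the two simplices\<close>

theorem theorem0p1:
  fixes k d :: nat
  assumes "2 * k \<le> d"
  shows "\<exists>P p. gorenstein_fano_polytope d P \<and> ehrhart_polynomial P p \<and>
    card {z::complex. poly p z = 0} = d \<and>
    card {z::complex. poly p z = 0 \<and> z \<notin> \<real>} = 2 * k \<and>
    card {z::complex. poly p z = 0 \<and> z \<in> \<real>} = d - 2 * k \<and>
    (\<forall>z::complex. poly p z = 0 \<and> z \<notin> \<real> \<longrightarrow> Re z = - 1 / 2) \<and>
    (\<forall>z::complex. poly p z = 0 \<and> z \<in> \<real> \<longrightarrow> Re z \<in> {-1<..<0})"
proof -
  define m where "m = d - 2 * k"
  define B where "B = {..<m}"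
  define C where "C = {m..<d}"
  have BC: "finite B" "finite C" "card B = m" "card C = 2 * k" "B \<inter> C = {}" "B \<union> C = {..<d}"
    using assms by (auto simp: B_def C_def m_def)
  define V where "V = dilated_simplex_vertices B + fano_simplex_vertices C"
  define p where "p = dilated_simplex_poly m * fano_simplex_poly (2 * k)"
  note pairB = reflexive_pair_simplex[OF BC(1)]
  note pairC = reflexive_pair_sym[OF reflexive_pair_simplex[OF BC(2)]]
  have gorenstein: "gorenstein_fano_polytope d (convex hull V)"
    using reflexive_pair_product[OF pairB pairC BC(5)] gorenstein_fano_reflexive_pair
    unfolding BC(6) V_def by blast
  have count: "ehrhart_count (convex hull V) n =
      ehrhart_count (convex hull dilated_simplex_vertices B) n *
      ehrhart_count (convex hull fano_simplex_vertices C) n" for n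
    unfolding V_def convex_hull_set_plus
    by (rule ehrhart_count_set_plus[OF _ _ BC(5)])
      (use pairB pairC reflexive_pair_hull_in_coord_space in blast)+
  have "poly p (of_nat n) = of_nat (ehrhart_count (convex hull V) n)" for n
  proof -
    have "poly (dilated_simplex_poly m) (of_nat n) =
        of_nat (ehrhart_count (convex hull dilated_simplex_vertices B) n)"
      unfolding ehrhart_count_dilated_simplex[OF BC(1)] BC(3) by (rule poly_dilated_simplex_poly)
    moreover have "of_nat ((n + 2 * k + 1) choose (2 * k + 1)) =
        of_nat (ehrhart_count (convex hull fano_simplex_vertices C) n)
        + (of_nat (n choose (2 * k + 1)) :: complex)"
      using ehrhart_count_fano_simplex[OF BC(2), of n] unfolding BC(4) by (metis of_nat_add)
    then have "poly (fano_simplex_poly (2 * k)) (of_nat n) =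
        of_nat (ehrhart_count (convex hull fano_simplex_vertices C) n)"
      unfolding poly_fano_simplex_poly by simp
    ultimately show ?thesis by (simp add: p_def count)
  qed
  then have ehrhart: "ehrhart_polynomial (convex hull V) p"
    by (simp add: ehrhart_polynomial_def)
  define R where "R = {z. poly (dilated_simplex_poly m) z = 0}"
  define S where "S = {z. poly (fano_simplex_poly (2 * k)) z = 0}"
  have R: "z \<in> \<real>" "Re z \<in> {-1<..<0}" if "z \<in> R" for z
    using that unfolding R_def dilated_simplex_poly_roots by auto
  have S: "z \<notin> \<real>" "Re z = - 1 / 2" if "z \<in> S" for z
    using that fano_simplex_poly_root_not_real[of "2 * k" z] fano_simplex_poly_root_Re[of "2 * k" z]
    by (auto simp: S_def)
  have root_iff: "poly p z = 0 \<longleftrightarrow> z \<in> R \<or> z \<in> S" for z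
    by (simp add: p_def R_def S_def)
  have card: "card R = m" "card S = 2 * k"
    by (simp_all add: R_def S_def card_dilated_simplex_poly_roots card_fano_simplex_poly_roots)
  have nonreal: "{z. poly p z = 0 \<and> z \<notin> \<real>} = S" and real: "{z. poly p z = 0 \<and> z \<in> \<real>} = R"
    unfolding root_iff using R(1) S(1) by blast+
  have "p \<noteq> 0"
  proof
    assume "p = 0"
    then have "R \<union> S = UNIV" using root_iff by auto
    then have "(0::complex) \<in> R \<or> (0::complex) \<in> S" by blast
    then show False using R(2)[of 0] S(1)[of 0] by auto
  qed
  then have "finite {z. poly p z = 0}" by (rule poly_roots_finite)
  moreover have "{z. poly p z = 0} = R \<union> S" unfolding root_iff by blast
  moreover have "R \<inter> S = {}" using R(1) S(1) by blast
  ultimately have "card {z. poly p z = 0} = m + 2 * k"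
    by (simp add: card_Un_disjoint card)
  then have "card {z. poly p z = 0} = d" using assms by (simp add: m_def)
  moreover have "\<forall>z. poly p z = 0 \<and> z \<notin> \<real> \<longrightarrow> Re z = - 1 / 2"
    using nonreal S(2) by blast
  moreover have "\<forall>z. poly p z = 0 \<and> z \<in> \<real> \<longrightarrow> Re z \<in> {-1<..<0}"
    using real R(2) by blast
  ultimately show ?thesis
    using gorenstein ehrhart card unfolding nonreal[symmetric] real[symmetric] m_def by blast
qed

end
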